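(* Let $\mathbb{K}\in\{\mathbb{R},\mathbb{C}\}$. The modified Krawczyk algorithm described in the context, applied to an interval generalized Sylvester matrix equation $\mathbf{A}X\mathbf{B}+\mathbf{C}X\mathbf{D}=\mathbf{F}$ with $\mathbf{A},\mathbf{C}\in\mathbb{IK}^{m\times m}$, $\mathbf{B},\mathbf{D}\in\mathbb{IK}^{n\times n}$, $\mathbf{F}\in\mathbb{IK}^{m\times n}$, requires $O(m^{3}+n^{3})$ arithmetic operations per iteration.
   Context: $\mathbb{IK}^{p\times q}$ is the set of $p\times q$ matrices whose entries are intervals $\langle x^{c},x^{\Delta}\rangle=\operatorname{midrad}(x^c,x^\Delta)=\{x\in\mathbb{K}:|x-x^{c}|\le x^{\Delta}\}$. For an interval matrix $\mathbf{M}$, $M^{c}=\operatorname{mid}(\mathbf{M})$, $M^{\Delta}=\operatorname{rad}(\mathbf{M})$ and $\operatorname{mag}(\mathbf{M})=|M^{c}|+M^{\Delta}$. $./$ is entrywise division. Basic arithmetic operations on intervals cost a bounded number of arithmetic operations, and matrix products are computed by the standard formula. It is assumed that $A^{c},C^{c}$ are simultaneously diagonalizable and $B^{c},D^{c}$ are simultaneously diagonalizable: $A^{c}=UD_AU^{-1}$, $C^{c}=UD_CU^{-1}$, $B^{c}=VD_BV^{-1}$, $D^{c}=VD_DV^{-1}$ with $D_A,D_B,D_C,D_D$ diagonal. Algorithm. Input: $\mathbf{A},\mathbf{B},\mathbf{C},\mathbf{D},\mathbf{F}$. 1. Compute $U,V,D_A,D_B,D_C,D_D$ by a standard floating-point spectral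 decomposition routine (whose cost is counted as cubic in the dimension of the matrices involved). 2. Using interval arithmetic, compute $\mathbf{A}_p=U^{-1}\mathbf{A}U$, $\mathbf{B}_p=V^{-1}\mathbf{B}V$, $\mathbf{C}_p=U^{-1}\mathbf{C}U$, $\mathbf{D}_p=V^{-1}\mathbf{D}V$, $\mathbf{F}_p=U^{-1}\mathbf{F}V$, and replace each of $\mathbf{A}_p,\mathbf{B}_p,\mathbf{C}_p,\mathbf{D}_p$ by the enclosure obtained by keeping its diagonal entries and replacing each off-diagonal entry $\mathbf{x}$ by $\operatorname{midrad}(0,\operatorname{mag}(\mathbf{x}))$. 3. Form $S\in\mathbb{K}^{m\times n}$ with $S_{ij}=(D_B)_{jj}(D_A)_{ii}+(D_D)_{jj}(D_C)_{ii}$. 4. Compute $\tilde X=\operatorname{mid}(\mathbf{F}_p)./S$. 5. Compute $\mathbf{M}=(\mathbf{F}_p-(\mathbf{A}_p\tilde X)\mathbf{B}_p-(\mathbf{C}_p\tilde X)\mathbf{D}_p)./S$. 6. Put $\mathbf{H}=\mathbf{M}$, $\mathrm{ready}=0$, $k=0$, $k_{\max}=15$. 7. Put $\mathbf{E}=0.1\cdot\operatorname{rad}(\mathbf{M})\cdot[-1,1]+\operatorname{midrad}(0,10\epsilon)$, where $\epsilon$ is the machine precision. 8. While not ready and $k<k_{\max}$: put $\mathbf{X}=\mathbf{H}+\mathbf{E}$; $k=k+1$; compute $\mathbf{N}=\big\langle 0,(A_p^{\Delta}X^{\Delta}|B_p^{c}|+\operatorname{mag}(\mathbf{A}_p)X^{\Delta}B_p^{\Delta}+C_p^{\Delta}X^{\Delta}|D_p^{c}|+\operatorname{mag}(\mathbf{C}_p)X^{\Delta}D_p^{\Delta})./|S|\big\rangle$;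 put $\mathbf{H}=\mathbf{M}+\mathbf{N}$; set ready to the truth value of the entrywise test $\mathbf{H}\subseteq\operatorname{int}(\mathbf{X})$. 9. If ready, output $\mathbf{Z}=U(\tilde X+\mathbf{X})V^{-1}$; otherwise report that the method cannot obtain an outer estimation. *)

theory Defs
  imports
    "HOL-Analysis.Analysis"
    "HOL-Library.Monad_Syntax"
    "Jordan_Normal_Form.Matrix"
begin

section \<open>Computations with an operation count\<close>

text \<open>
  A computation is a value paired with the number of arithmetic operations spent on it.
  Operations on point data (elements of \<open>\<bbbK>\<close> and radii) are charged one each through \<open>op1\<close>,
  \<open>op2\<close>; comparisons and absolute values are charged as well.  Data movement, loop control and
  access to the stored midpoint and radius of an interval are free.
\<close>

type_synonym 'a counted = "'a \<times> nat"

definition bind_counted :: "'a counted \<Rightarrow> ('a \<Rightarrow> 'b counted) \<Rightarrow> 'b counted" where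
  "bind_counted x f = (fst (f (fst x)), snd x + snd (f (fst x)))"

adhoc_overloading Monad_Syntax.bind \<rightleftharpoons> bind_counted

definition ret :: "'a \<Rightarrow> 'a counted" where
  "ret x = (x, 0)"

definition op1 :: "('a \<Rightarrow> 'b) \<Rightarrow> 'a \<Rightarrow> 'b counted" where
  "op1 f x = (f x, 1)"

definition op2 :: "('a \<Rightarrow> 'b \<Rightarrow> 'c) \<Rightarrow> 'a \<Rightarrow> 'b \<Rightarrow> 'c counted" where
  "op2 f x y = (f x y, 1)"

definition mat_counted :: "nat \<Rightarrow> nat \<Rightarrow> (nat \<times> nat \<Rightarrow> 'a counted) \<Rightarrow> 'a mat counted" where
  "mat_counted p q f = (mat p q (\<lambda>ij. fst (f ij)), \<Sum>i<p. \<Sum>j<q. snd (f (i, j)))"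

definition map_counted :: "('a \<Rightarrow> 'b counted) \<Rightarrow> 'a mat \<Rightarrow> 'b mat counted" where
  "map_counted f P = mat_counted (dim_row P) (dim_col P) (\<lambda>ij. f (P $$ ij))"

definition zip_counted :: "('a \<Rightarrow> 'b \<Rightarrow> 'c counted) \<Rightarrow> 'a mat \<Rightarrow> 'b mat \<Rightarrow> 'c mat counted" where
  "zip_counted f P Q = mat_counted (dim_row P) (dim_col P) (\<lambda>ij. f (P $$ ij) (Q $$ ij))"

primrec sum_counted :: "('a \<Rightarrow> 'a \<Rightarrow> 'a counted) \<Rightarrow> 'a \<Rightarrow> (nat \<Rightarrow> 'a counted) \<Rightarrow> nat \<Rightarrow> 'a counted" where
  "sum_counted pl z f 0 = ret z"
| "sum_counted pl z f (Suc k) = do { s \<leftarrow> sum_counted pl z f k; t \<leftarrow> f k; pl s t }"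

definition mult_counted ::
    "('a \<Rightarrow> 'a \<Rightarrow> 'a counted) \<Rightarrow> 'a \<Rightarrow> ('a \<Rightarrow> 'a \<Rightarrow> 'a counted) \<Rightarrow> 'a mat \<Rightarrow> 'a mat \<Rightarrow> 'a mat counted" where
  "mult_counted pl z ti P Q = mat_counted (dim_row P) (dim_col Q)
     (\<lambda>(i, j). sum_counted pl z (\<lambda>k. ti (P $$ (i, k)) (Q $$ (k, j))) (dim_col P))"

text \<open>With exact scalar operations this is the library's matrix product.\<close>

lemma fst_sum_counted: "fst (sum_counted (op2 (+)) (0 :: 'a :: semiring_0) f k) = (\<Sum>l = 0..<k. fst (f l))"
  by (induction k) (auto simp: ret_def bind_counted_def op2_def)

lemma fst_mult_counted:
  assumes "P \<in> carrier_mat p q" "Q \<in> carrier_mat q r"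
  shows "fst (mult_counted (op2 (+)) (0 :: 'a :: semiring_0) (op2 (*)) P Q) = P * Q"
  using assms
  by (intro eq_matI)
     (auto simp: mult_counted_def mat_counted_def fst_sum_counted scalar_prod_def, auto simp: op2_def)


section \<open>Matrix inversion\<close>

text \<open>
  The algorithm multiplies by \<open>U\<inverse>\<close> and \<open>V\<inverse>\<close>.  They are obtained from \<open>U\<close> and \<open>V\<close> by Gauss-Jordan
  elimination with partial pivoting on the augmented matrix \<open>(U | I)\<close>.
\<close>

primrec pivot_counted :: "'k :: real_normed_field mat \<Rightarrow> nat \<Rightarrow> nat \<Rightarrow> nat counted" where
  "pivot_counted W k 0 = ret k"
| "pivot_counted W k (Suc r) = do {
     p \<leftarrow> pivot_counted W k r;
     a \<leftarrow> op1 norm (W $$ (p, k));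
     b \<leftarrow> op1 norm (W $$ (k + Suc r, k));
     less \<leftarrow> op2 (<) a b;
     ret (if less then k + Suc r else p) }"

definition swap_rows :: "nat \<Rightarrow> nat \<Rightarrow> 'a mat \<Rightarrow> 'a mat" where
  "swap_rows k p W = mat (dim_row W) (dim_col W)
     (\<lambda>(i, j). W $$ (if i = k then p else if i = p then k else i, j))"

definition gauss_jordan_step :: "nat \<Rightarrow> 'k :: real_normed_field mat \<Rightarrow> 'k mat counted" where
  "gauss_jordan_step k W = do {
     p \<leftarrow> pivot_counted W k (dim_row W - Suc k);
     let W1 = swap_rows k p W;
     W2 \<leftarrow> mat_counted (dim_row W) (dim_col W)
       (\<lambda>(i, j). if i = k then op2 (/) (W1 $$ (k, j)) (W1 $$ (k, k)) else ret (W1 $$ (i, j)));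
     mat_counted (dim_row W) (dim_col W)
       (\<lambda>(i, j). if i = k then ret (W2 $$ (k, j))
                 else do { t \<leftarrow> op2 (*) (W2 $$ (i, k)) (W2 $$ (k, j)); op2 (-) (W2 $$ (i, j)) t }) }"

primrec gauss_jordan_steps :: "'k :: real_normed_field mat \<Rightarrow> nat \<Rightarrow> 'k mat counted" where
  "gauss_jordan_steps W 0 = ret W"
| "gauss_jordan_steps W (Suc k) = do { W' \<leftarrow> gauss_jordan_steps W k; gauss_jordan_step k W' }"

definition inverse_counted :: "'k :: real_normed_field mat \<Rightarrow> 'k mat counted" where
  "inverse_counted U = (let d = dim_row U in do {
     W \<leftarrow> gauss_jordan_steps
            (mat d (2 * d) (\<lambda>(i, j). if j < d then U $$ (i, j) else if j = d + i then 1 else 0)) d;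
     ret (mat d d (\<lambda>(i, j). W $$ (i, d + j))) })"

lemma pivot_counted:
  assumes "k + r < dim_row W"
  shows "fst (pivot_counted W k r) \<in> {k..k + r} \<and>
    (\<forall>i \<in> {k..k + r}. norm (W $$ (i, k)) \<le> norm (W $$ (fst (pivot_counted W k r), k)))"
  using assms
proof (induction r)
  case 0
  then show ?case by (simp add: ret_def)
next
  case (Suc r)
  define p where "p = fst (pivot_counted W k r)"
  have p: "p \<in> {k..k + r}" and max: "\<And>i. i \<in> {k..k + r} \<Longrightarrow> norm (W $$ (i, k)) \<le> norm (W $$ (p, k))"
    using Suc by (auto simp: p_def)
  have eq: "fst (pivot_counted W k (Suc r)) =
      (if norm (W $$ (p, k)) < norm (W $$ (k + Suc r, k)) then k + Suc r else p)"
    by (simp add: ret_def bind_counted_def op1_def op2_def p_def)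
  have "norm (W $$ (i, k)) \<le> norm (W $$ (fst (pivot_counted W k (Suc r)), k))"
    if "i \<in> {k..k + Suc r}" for i
  proof (cases "i = k + Suc r")
    case True
    then show ?thesis unfolding eq by simp
  next
    case False
    then show ?thesis unfolding eq using max[of i] that by auto
  qed
  moreover have "fst (pivot_counted W k (Suc r)) \<in> {k..k + Suc r}"
    unfolding eq using p by auto
  ultimately show ?case by blast
qed

lemma gauss_jordan_step_dim:
  "dim_row (fst (gauss_jordan_step k W)) = dim_row W"
  "dim_col (fst (gauss_jordan_step k W)) = dim_col W"
  by (simp_all add: gauss_jordan_step_def bind_counted_def Let_def mat_counted_def)

lemma gauss_jordan_step_index:
  assumes "i < dim_row W" "j < dim_col W" "k < dim_row W" "k < dim_col W"
    and "p = fst (pivot_counted W k (dim_row W - Suc k))"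
  shows "fst (gauss_jordan_step k W) $$ (i, j) =
    (if i = k then W $$ (p, j) / W $$ (p, k)
     else let i' = (if i = p then k else i)
          in W $$ (i', j) - W $$ (i', k) * (W $$ (p, j) / W $$ (p, k)))"
  using assms
  by (auto simp: gauss_jordan_step_def bind_counted_def Let_def mat_counted_def swap_rows_def
      ret_def op2_def)

definition gauss_jordan_inv :: "nat \<Rightarrow> 'k :: real_normed_field mat \<Rightarrow> nat \<Rightarrow> 'k mat \<Rightarrow> bool" where
  "gauss_jordan_inv d U k W \<longleftrightarrow> W \<in> carrier_mat d (2 * d) \<and>
     (\<forall>i<d. \<forall>j<d. W $$ (i, j) = (\<Sum>l<d. W $$ (i, d + l) * U $$ (l, j))) \<and>
     (\<forall>v. (\<forall>i<d. (\<Sum>j<d. W $$ (i, j) * v j) = 0) \<longrightarrow> (\<forall>j<d. v j = 0)) \<and>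
     (\<forall>i<d. \<forall>j<k. W $$ (i, j) = (if i = j then 1 else 0))"

lemma gauss_jordan_step_inv:
  assumes inv: "gauss_jordan_inv d U k W" and k: "k < d"
  shows "gauss_jordan_inv d U (Suc k) (fst (gauss_jordan_step k W))"
proof -
  let ?W = "fst (gauss_jordan_step k W)"
  define p where "p = fst (pivot_counted W k (dim_row W - Suc k))"
  from inv have W: "dim_row W = d" "dim_col W = 2 * d"
    and rows: "\<And>i j. i < d \<Longrightarrow> j < d \<Longrightarrow> W $$ (i, j) = (\<Sum>l<d. W $$ (i, d + l) * U $$ (l, j))"
    and ker: "\<And>v j. (\<And>i. i < d \<Longrightarrow> (\<Sum>j<d. W $$ (i, j) * v j) = 0) \<Longrightarrow> j < d \<Longrightarrow> v j = 0"
    and unit: "\<And>i j. i < d \<Longrightarrow> j < k \<Longrightarrow> W $$ (i, j) = (if i = j then 1 else 0)"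
    by (auto simp: gauss_jordan_inv_def)
  from pivot_counted[of k "d - Suc k" W] k W
  have p: "k \<le> p" "p < d" and pmax: "\<And>i. k \<le> i \<Longrightarrow> i < d \<Longrightarrow> norm (W $$ (i, k)) \<le> norm (W $$ (p, k))"
    by (auto simp: p_def)
  have nz: "W $$ (p, k) \<noteq> 0"
  proof
    assume 0: "W $$ (p, k) = 0"
    have z: "W $$ (i, k) = 0" if "k \<le> i" "i < d" for i
      using pmax[OF that] 0 by simp
    define v where "v j = (if j < k then - W $$ (j, k) else if j = k then 1 else 0)" for j
    have "(\<Sum>j<d. W $$ (i, j) * v j) = 0" if i: "i < d" for i
    proof -
      have "(\<Sum>j<d. W $$ (i, j) * v j) = (\<Sum>j\<in>{..<k} \<union> {k}. W $$ (i, j) * v j)"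
        using k by (intro sum.mono_neutral_right) (auto simp: v_def)
      also have "\<dots> = (\<Sum>j<k. W $$ (i, j) * v j) + W $$ (i, k)"
        by (subst sum.union_disjoint) (auto simp: v_def)
      also have "(\<Sum>j<k. W $$ (i, j) * v j) = (\<Sum>j<k. if i = j then v j else 0)"
        using unit i by (intro sum.cong) auto
      also have "\<dots> = (if i < k then v i else 0)"
        by (subst sum.delta') auto
      finally show ?thesis
        using z[of i] i by (auto simp: v_def)
    qed
    from ker[of v, OF this k] show False by (simp add: v_def)
  qed
  have idx: "?W $$ (i, j) = (if i = k then W $$ (p, j) / W $$ (p, k)
     else W $$ (if i = p then k else i, j)
       - W $$ (if i = p then k else i, k) * (W $$ (p, j) / W $$ (p, k)))"
    if "i < d" "j < 2 * d" for i j
    using gauss_jordan_step_index[of i W j k p] that k W by (simp add: Let_def p_def)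
  have g1: "?W \<in> carrier_mat d (2 * d)"
    using W by (auto simp: gauss_jordan_step_dim)
  have g2: "?W $$ (i, j) = (\<Sum>l<d. ?W $$ (i, d + l) * U $$ (l, j))" if i: "i < d" and j: "j < d" for i j
  proof (cases "i = k")
    case True
    have "(\<Sum>l<d. ?W $$ (i, d + l) * U $$ (l, j)) = (\<Sum>l<d. W $$ (p, d + l) * U $$ (l, j)) / W $$ (p, k)"
      using True i by (auto simp: idx sum_divide_distrib)
    also have "\<dots> = W $$ (p, j) / W $$ (p, k)"
      using rows[OF p(2) j] by simp
    finally show ?thesis
      using True i j by (simp add: idx)
  next
    case False
    define q where "q = (if i = p then k else i)"
    have q: "q < d" using i k by (simp add: q_def)
    have "(\<Sum>l<d. ?W $$ (i, d + l) * U $$ (l, j)) =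
      (\<Sum>l<d. W $$ (q, d + l) * U $$ (l, j) - W $$ (q, k) / W $$ (p, k) * (W $$ (p, d + l) * U $$ (l, j)))"
      using False i by (intro sum.cong) (auto simp: idx q_def algebra_simps)
    also have "\<dots> = W $$ (q, j) - W $$ (q, k) / W $$ (p, k) * W $$ (p, j)"
      by (simp only: sum_subtractf sum_distrib_left[symmetric] rows[OF q j] rows[OF p(2) j])
    finally show ?thesis
      using False i j by (simp add: idx q_def)
  qed
  have g3: "v j = 0" if v: "\<And>i. i < d \<Longrightarrow> (\<Sum>j<d. ?W $$ (i, j) * v j) = 0" and j: "j < d" for v j
  proof (rule ker[OF _ j])
    have "(\<Sum>j<d. ?W $$ (k, j) * v j) = (\<Sum>j<d. W $$ (p, j) * v j) / W $$ (p, k)"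
      using k by (auto simp: idx sum_divide_distrib)
    with v[OF k] nz have pv: "(\<Sum>j<d. W $$ (p, j) * v j) = 0"
      by simp
    have qv: "(\<Sum>j<d. W $$ (if i = p then k else i, j) * v j) = 0" if i: "i < d" "i \<noteq> k" for i
    proof -
      let ?q = "if i = p then k else i"
      have "(\<Sum>j<d. ?W $$ (i, j) * v j) =
        (\<Sum>j<d. W $$ (?q, j) * v j - W $$ (?q, k) / W $$ (p, k) * (W $$ (p, j) * v j))"
        using i by (intro sum.cong) (auto simp: idx algebra_simps)
      also have "\<dots> = (\<Sum>j<d. W $$ (?q, j) * v j)"
        by (simp only: sum_subtractf sum_distrib_left[symmetric] pv) simp
      finally show ?thesis using v[OF i(1)] by simp
    qed
    fix i assume i: "i < d"
    show "(\<Sum>j<d. W $$ (i, j) * v j) = 0"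
    proof (cases "i = p")
      case True
      then show ?thesis using pv by simp
    next
      case False
      show ?thesis
      proof (cases "i = k")
        case True
        with False qv[of p] p show ?thesis by simp
      next
        case ik: False
        then show ?thesis using False qv[OF i] by simp
      qed
    qed
  qed
  have g4: "?W $$ (i, j) = (if i = j then 1 else 0)" if i: "i < d" and j: "j < Suc k" for i j
  proof (cases "j = k")
    case True
    then show ?thesis using i k nz by (simp add: idx)
  next
    case False
    then have j: "j < k" using j by simp
    have pj: "W $$ (p, j) = 0" using unit[OF p(2) j] p j by simp
    show ?thesis
    proof (cases "i = k")
      case True
      then show ?thesis using i j k pj by (simp add: idx)
    next
      case False
      have "?W $$ (i, j) = W $$ (if i = p then k else i, j)"
        using False pj idx[of i j] i j k by simp
      also have "\<dots> = (if i = j then 1 else 0)"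
      proof (cases "i = p")
        case True
        then show ?thesis using unit[OF k j] p j by simp
      next
        case False
        then show ?thesis using unit[OF i j] by simp
      qed
      finally show ?thesis .
    qed
  qed
  have "\<forall>v. (\<forall>i<d. (\<Sum>j<d. ?W $$ (i, j) * v j) = 0) \<longrightarrow> (\<forall>j<d. v j = 0)"
  proof (intro allI impI)
    fix v j
    assume "\<forall>i<d. (\<Sum>j<d. ?W $$ (i, j) * v j) = 0" "j < d"
    then show "v j = 0" using g3[of v j] by blast
  qed
  moreover have "\<forall>i<d. \<forall>j<d. ?W $$ (i, j) = (\<Sum>l<d. ?W $$ (i, d + l) * U $$ (l, j))"
    by (intro allI impI) (rule g2)
  moreover have "\<forall>i<d. \<forall>j<Suc k. ?W $$ (i, j) = (if i = j then 1 else 0)"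
    by (intro allI impI) (rule g4)
  ultimately show ?thesis
    unfolding gauss_jordan_inv_def using g1 by (intro conjI)
qed

lemma inverse_counted_inverts:
  assumes U: "U \<in> carrier_mat d d" and inv: "invertible_mat U"
  shows "fst (inverse_counted U) \<in> carrier_mat d d"
    "inverts_mat (fst (inverse_counted U)) U" "inverts_mat U (fst (inverse_counted U))"
proof -
  define W0 where "W0 = mat d (2 * d) (\<lambda>(i, j). if j < d then U $$ (i, j) else if j = d + i then 1 else 0)"
  define W where "W = fst (gauss_jordan_steps W0 d)"
  let ?R = "fst (inverse_counted U)"
  have R: "?R = mat d d (\<lambda>(i, j). W $$ (i, d + j))"
    using U by (simp add: inverse_counted_def W_def W0_def Let_def bind_counted_def ret_def)
  then show carrier: "?R \<in> carrier_mat d d" by simp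
  from inv obtain B where B: "inverts_mat U B" "inverts_mat B U"
    by (auto simp: invertible_mat_def)
  have "dim_col (B * U) = dim_row B" "dim_col (U * B) = dim_row U"
    using B by (simp_all add: inverts_mat_def)
  then have Bc: "B \<in> carrier_mat d d"
    using B(1) U by (auto simp: inverts_mat_def)
  have BU: "B * U = 1\<^sub>m d" and UB: "U * B = 1\<^sub>m d"
    using B U Bc by (auto simp: inverts_mat_def)
  have "gauss_jordan_inv d U 0 W0"
  proof -
    have "v j = 0" if v: "\<And>i. i < d \<Longrightarrow> (\<Sum>j<d. W0 $$ (i, j) * v j) = 0" and j: "j < d" for v j
    proof -
      have Uv: "U *\<^sub>v vec d v = 0\<^sub>v d"
        using v U by (intro eq_vecI) (auto simp: W0_def scalar_prod_def atLeast0LessThan)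
      have "vec d v = (B * U) *\<^sub>v vec d v" by (simp add: BU)
      also have "\<dots> = B *\<^sub>v (U *\<^sub>v vec d v)" using Bc U by (intro assoc_mult_mat_vec) auto
      also have "\<dots> = 0\<^sub>v d" unfolding Uv using Bc by auto
      finally show ?thesis using j by (simp add: vec_eq_iff)
    qed
    moreover have "W0 $$ (i, j) = (\<Sum>l<d. W0 $$ (i, d + l) * U $$ (l, j))" if "i < d" "j < d" for i j
    proof -
      have "(\<Sum>l<d. W0 $$ (i, d + l) * U $$ (l, j)) = (\<Sum>l<d. if l = i then U $$ (l, j) else 0)"
        using that by (intro sum.cong) (auto simp: W0_def)
      then show ?thesis using that by (simp add: W0_def)
    qed
    ultimately show ?thesis
      unfolding gauss_jordan_inv_def by (auto simp: W0_def)
  qed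
  then have "k \<le> d \<Longrightarrow> gauss_jordan_inv d U k (fst (gauss_jordan_steps W0 k))" for k
    by (induction k) (auto simp: ret_def bind_counted_def gauss_jordan_step_inv)
  then have "gauss_jordan_inv d U d W" by (simp add: W_def)
  then have "?R * U = 1\<^sub>m d"
    using U by (intro eq_matI) (auto simp: R gauss_jordan_inv_def scalar_prod_def atLeast0LessThan)
  moreover have "?R = B"
  proof -
    have "?R = ?R * (U * B)" using carrier UB by simp
    also have "\<dots> = ?R * U * B" using carrier U Bc by (intro assoc_mult_mat[symmetric])
    also have "\<dots> = B" using calculation \<open>?R * U = 1\<^sub>m d\<close> Bc by simp
    finally show ?thesis .
  qed
  ultimately show "inverts_mat ?R U" "inverts_mat U ?R"
    using U Bc UB by (auto simp: inverts_mat_def)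
qed

section \<open>Interval matrices\<close>

text \<open>
  By the Gelfand-Mazur theorem \<open>\<real>\<close> and \<open>\<complex>\<close> are, up to isometric isomorphism, the only instances
  of \<^class>\<open>real_normed_field\<close>; a type variable of this class therefore plays the role of \<open>\<bbbK>\<close>.
\<close>

datatype 'k ivl = midrad (mid: 'k) (rad: real)

definition ivl_set :: "'k :: real_normed_field ivl \<Rightarrow> 'k set" where
  "ivl_set x = {t. norm (t - mid x) \<le> rad x}"

definition ivl_mats :: "nat \<Rightarrow> nat \<Rightarrow> 'k :: real_normed_field ivl mat set" where
  "ivl_mats p q = {M \<in> carrier_mat p q. \<forall>i<p. \<forall>j<q. 0 \<le> rad (M $$ (i, j))}"

abbreviation point :: "'k :: real_normed_field \<Rightarrow> 'k ivl" where
  "point t \<equiv> midrad t 0"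

definition mag_counted :: "'k :: real_normed_field ivl \<Rightarrow> real counted" where
  "mag_counted x = do { a \<leftarrow> op1 norm (mid x); op2 (+) a (rad x) }"

text \<open>
  The interval arithmetic in use is a parameter: any enclosing implementation (circular, or
  infimum-supremum based, with or without outward rounding) whose basic operations cost at most
  \<open>\<kappa>\<close> arithmetic operations each.  The last component decides \<open>X \<subseteq> int Y\<close>.
\<close>

record 'k ivl_ops =
  iadd :: "'k ivl \<Rightarrow> 'k ivl \<Rightarrow> 'k ivl counted"
  isub :: "'k ivl \<Rightarrow> 'k ivl \<Rightarrow> 'k ivl counted"
  imul :: "'k ivl \<Rightarrow> 'k ivl \<Rightarrow> 'k ivl counted"
  idiv :: "'k ivl \<Rightarrow> 'k ivl \<Rightarrow> 'k ivl counted"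
  iinside :: "'k ivl \<Rightarrow> 'k ivl \<Rightarrow> bool counted"

definition encloses ::
    "('k :: real_normed_field \<Rightarrow> 'k \<Rightarrow> 'k) \<Rightarrow> 'k ivl \<Rightarrow> 'k ivl \<Rightarrow> 'k ivl \<Rightarrow> bool" where
  "encloses f X Y Z \<longleftrightarrow> (\<forall>x \<in> ivl_set X. \<forall>y \<in> ivl_set Y. f x y \<in> ivl_set Z)"

definition ivl_arithmetic :: "nat \<Rightarrow> 'k :: real_normed_field ivl_ops \<Rightarrow> bool" where
  "ivl_arithmetic \<kappa> ar \<longleftrightarrow> (\<forall>X Y.
     encloses (+) X Y (fst (iadd ar X Y)) \<and> snd (iadd ar X Y) \<le> \<kappa> \<and>
     encloses (-) X Y (fst (isub ar X Y)) \<and> snd (isub ar X Y) \<le> \<kappa> \<and>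
     encloses (*) X Y (fst (imul ar X Y)) \<and> snd (imul ar X Y) \<le> \<kappa> \<and>
     (0 \<notin> ivl_set Y \<longrightarrow> encloses (/) X Y (fst (idiv ar X Y))) \<and> snd (idiv ar X Y) \<le> \<kappa> \<and>
     fst (iinside ar X Y) = (ivl_set X \<subseteq> interior (ivl_set Y)) \<and> snd (iinside ar X Y) \<le> \<kappa>)"

abbreviation imult :: "'k :: real_normed_field ivl_ops \<Rightarrow> 'k ivl mat \<Rightarrow> 'k ivl mat \<Rightarrow> 'k ivl mat counted" where
  "imult ar \<equiv> mult_counted (iadd ar) (point 0) (imul ar)"

abbreviation rmult :: "real mat \<Rightarrow> real mat \<Rightarrow> real mat counted" where
  "rmult \<equiv> mult_counted (op2 (+)) 0 (op2 (*))"


section \<open>The spectral decomposition routine\<close>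

definition simultaneously_diagonalizable :: "'k :: real_normed_field mat \<Rightarrow> 'k mat \<Rightarrow> bool" where
  "simultaneously_diagonalizable P Q \<longleftrightarrow> (\<exists>D1 D2 U Ui.
     similar_mat_wit P D1 U Ui \<and> similar_mat_wit Q D2 U Ui \<and> diagonal_mat D1 \<and> diagonal_mat D2)"

text \<open>
  A routine maps a pair \<open>P\<close>, \<open>Q\<close> to computed factors \<open>U\<close>, \<open>D1\<close>, \<open>D2\<close> with \<open>P \<approx> U D1 U\<inverse>\<close>,
  \<open>Q \<approx> U D2 U\<inverse>\<close>.  It works in floating-point arithmetic, so that in general these relations hold
  only approximately; no accuracy is demanded, and exact factors are included as a special case.
  Its cost is charged as a whole, cubic in the dimension.
\<close>

type_synonym 'k spectral_routine = "'k mat \<Rightarrow> 'k mat \<Rightarrow> ('k mat \<times> 'k mat \<times> 'k mat) counted"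

definition cubic_spectral_routine :: "nat \<Rightarrow> 'k :: real_normed_field spectral_routine \<Rightarrow> bool" where
  "cubic_spectral_routine \<sigma> R \<longleftrightarrow> (\<forall>d P Q.
     P \<in> carrier_mat d d \<longrightarrow> Q \<in> carrier_mat d d \<longrightarrow> simultaneously_diagonalizable P Q \<longrightarrow>
     (case R P Q of ((U, D1, D2), t) \<Rightarrow>
        {U, D1, D2} \<subseteq> carrier_mat d d \<and> invertible_mat U \<and> diagonal_mat D1 \<and> diagonal_mat D2 \<and>
        t \<le> \<sigma> * d ^ 3))"


section \<open>The modified Krawczyk algorithm\<close>

definition transform ::
    "'k :: real_normed_field ivl_ops \<Rightarrow> 'k mat \<Rightarrow> 'k ivl mat \<Rightarrow> 'k mat \<Rightarrow> 'k ivl mat counted" where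
  "transform ar P M Q = do {
     T \<leftarrow> imult ar (map_mat point P) M;
     imult ar T (map_mat point Q) }"

definition symmetrize_off_diagonal :: "'k :: real_normed_field ivl mat \<Rightarrow> 'k ivl mat counted" where
  "symmetrize_off_diagonal M = mat_counted (dim_row M) (dim_col M)
     (\<lambda>(i, j). if i = j then ret (M $$ (i, j))
               else do { r \<leftarrow> mag_counted (M $$ (i, j)); ret (midrad 0 r) })"

record 'k krawczyk_data =
  left_factor :: "'k mat"
  right_factor :: "'k mat"
  pre_A :: "'k ivl mat"
  pre_B :: "'k ivl mat"
  pre_C :: "'k ivl mat"
  pre_D :: "'k ivl mat"
  pre_S :: "'k mat"
  pre_X :: "'k mat"
  pre_M :: "'k ivl mat"
  pre_E :: "'k ivl mat"

text \<open>
  Everything before the loop.  The symmetric interval \<open>[-1, 1]\<close> is \<open>midrad 0 1\<close>; \<open>eps\<close> is the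
  machine precision.  The components \<open>left_factor\<close> and \<open>right_factor\<close> hold \<open>U\<close> and \<open>V\<inverse>\<close>.
\<close>

definition initialize ::
    "'k :: real_normed_field ivl_ops \<Rightarrow> 'k spectral_routine \<Rightarrow> real \<Rightarrow>
     'k ivl mat \<Rightarrow> 'k ivl mat \<Rightarrow> 'k ivl mat \<Rightarrow> 'k ivl mat \<Rightarrow> 'k ivl mat \<Rightarrow> 'k krawczyk_data counted" where
  "initialize ar R eps iA iB iC iD iF = do {
     (U, DA, DC) \<leftarrow> R (map_mat mid iA) (map_mat mid iC);
     (V, DB, DD) \<leftarrow> R (map_mat mid iB) (map_mat mid iD);
     Ui \<leftarrow> inverse_counted U;
     Vi \<leftarrow> inverse_counted V;
     A \<leftarrow> transform ar Ui iA U;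
     B \<leftarrow> transform ar Vi iB V;
     C \<leftarrow> transform ar Ui iC U;
     D \<leftarrow> transform ar Vi iD V;
     F \<leftarrow> transform ar Ui iF V;
     A \<leftarrow> symmetrize_off_diagonal A;
     B \<leftarrow> symmetrize_off_diagonal B;
     C \<leftarrow> symmetrize_off_diagonal C;
     D \<leftarrow> symmetrize_off_diagonal D;
     s \<leftarrow> mat_counted (dim_row iA) (dim_row iB) (\<lambda>(i, j). do {
            a \<leftarrow> op2 (*) (DB $$ (j, j)) (DA $$ (i, i));
            b \<leftarrow> op2 (*) (DD $$ (j, j)) (DC $$ (i, i));
            op2 (+) a b });
     X \<leftarrow> zip_counted (op2 (/)) (map_mat mid F) s;
     AX \<leftarrow> imult ar A (map_mat point X);
     AXB \<leftarrow> imult ar AX B;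
     CX \<leftarrow> imult ar C (map_mat point X);
     CXD \<leftarrow> imult ar CX D;
     G \<leftarrow> zip_counted (isub ar) F AXB;
     G \<leftarrow> zip_counted (isub ar) G CXD;
     m \<leftarrow> zip_counted (idiv ar) G (map_mat point s);
     e \<leftarrow> map_counted (\<lambda>x. do {
            r \<leftarrow> op2 (*) (1 / 10) (rad x);
            y \<leftarrow> imul ar (point (of_real r)) (midrad 0 1);
            z \<leftarrow> op2 (*) 10 eps;
            iadd ar y (midrad 0 z) }) m;
     ret \<lparr>left_factor = U, right_factor = Vi, pre_A = A, pre_B = B, pre_C = C, pre_D = D,
          pre_S = s, pre_X = X, pre_M = m, pre_E = e\<rparr> }"

text \<open>One pass through the loop body, from \<open>H\<close> to the new \<open>X\<close>, \<open>H\<close> and \<open>ready\<close>.\<close>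

definition iteration ::
    "'k :: real_normed_field ivl_ops \<Rightarrow> 'k krawczyk_data \<Rightarrow> 'k ivl mat \<Rightarrow>
     ('k ivl mat \<times> 'k ivl mat \<times> bool) counted" where
  "iteration ar d H = do {
     X \<leftarrow> zip_counted (iadd ar) H (pre_E d);
     let XR = map_mat rad X;
     magA \<leftarrow> map_counted mag_counted (pre_A d);
     magC \<leftarrow> map_counted mag_counted (pre_C d);
     absB \<leftarrow> map_counted (\<lambda>x. op1 norm (mid x)) (pre_B d);
     absD \<leftarrow> map_counted (\<lambda>x. op1 norm (mid x)) (pre_D d);
     absS \<leftarrow> map_counted (op1 norm) (pre_S d);
     T1 \<leftarrow> rmult (map_mat rad (pre_A d)) XR;
     T1 \<leftarrow> rmult T1 absB;
     T2 \<leftarrow> rmult magA XR;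
     T2 \<leftarrow> rmult T2 (map_mat rad (pre_B d));
     T3 \<leftarrow> rmult (map_mat rad (pre_C d)) XR;
     T3 \<leftarrow> rmult T3 absD;
     T4 \<leftarrow> rmult magC XR;
     T4 \<leftarrow> rmult T4 (map_mat rad (pre_D d));
     T \<leftarrow> zip_counted (op2 (+)) T1 T2;
     T \<leftarrow> zip_counted (op2 (+)) T T3;
     T \<leftarrow> zip_counted (op2 (+)) T T4;
     NR \<leftarrow> zip_counted (op2 (/)) T absS;
     H' \<leftarrow> zip_counted (iadd ar) (pre_M d) (map_mat (midrad 0) NR);
     I \<leftarrow> zip_counted (iinside ar) H' X;
     ret (X, H', \<forall>i < dim_row I. \<forall>j < dim_col I. I $$ (i, j)) }"

text \<open>
  The first argument is the number \<open>k_max - k\<close> of passes still allowed.  The result is the final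
  \<open>X\<close> if the loop ends with \<open>ready\<close>, together with the costs of the individual passes.
\<close>

primrec krawczyk_loop ::
    "nat \<Rightarrow> 'k :: real_normed_field ivl_ops \<Rightarrow> 'k krawczyk_data \<Rightarrow> 'k ivl mat \<Rightarrow>
     'k ivl mat option \<times> nat list" where
  "krawczyk_loop 0 ar d H = (None, [])"
| "krawczyk_loop (Suc r) ar d H = (case iteration ar d H of ((X, H', ready), t) \<Rightarrow>
     if ready then (Some X, [t])
     else (case krawczyk_loop r ar d H' of (res, ts) \<Rightarrow> (res, t # ts)))"

definition finalize ::
    "'k :: real_normed_field ivl_ops \<Rightarrow> 'k krawczyk_data \<Rightarrow> 'k ivl mat option \<Rightarrow>
     'k ivl mat option counted" where
  "finalize ar d res = (case res of
     None \<Rightarrow> ret None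
   | Some X \<Rightarrow> do {
       Y \<leftarrow> zip_counted (iadd ar) (map_mat point (pre_X d)) X;
       Z \<leftarrow> transform ar (left_factor d) Y (right_factor d);
       ret (Some Z) })"

record 'k krawczyk_run =
  outcome :: "'k ivl mat option"
  initial_cost :: nat
  iteration_costs :: "nat list"
  final_cost :: nat

definition modified_krawczyk ::
    "'k :: real_normed_field ivl_ops \<Rightarrow> 'k spectral_routine \<Rightarrow> real \<Rightarrow>
     'k ivl mat \<Rightarrow> 'k ivl mat \<Rightarrow> 'k ivl mat \<Rightarrow> 'k ivl mat \<Rightarrow> 'k ivl mat \<Rightarrow> 'k krawczyk_run" where
  "modified_krawczyk ar R eps iA iB iC iD iF =
     (let (d, t0) = initialize ar R eps iA iB iC iD iF;
          (res, ts) = krawczyk_loop 15 ar d (pre_M d);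
          (Z, t1) = finalize ar d res
      in \<lparr>outcome = Z, initial_cost = t0, iteration_costs = ts, final_cost = t1\<rparr>)"

end

theory Submission
  imports Defs
begin

text \<open>
  Every matrix that occurs has both dimensions in \<open>{m, n}\<close>.  A product of a \<open>p \<times> q\<close> by a
  \<open>q \<times> r\<close> matrix by the standard formula takes \<open>p q r\<close> scalar steps, and
  \<open>p q r \<le> max m n ^ 3 \<le> m\<^sup>3 + n\<^sup>3\<close>; an entrywise operation takes
  \<open>p q \<le> m\<^sup>3 + n\<^sup>3\<close> of them, because the dimensions are positive.  Gauss-Jordan elimination
  performs \<open>d\<close> steps on a \<open>d \<times> 2 d\<close> matrix, hence is cubic in \<open>d\<close>, and the spectral
  decompositions are cubic by assumption.  The point of the preconditioning is visible here: the loop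
  works with \<open>m \<times> m\<close>, \<open>n \<times> n\<close> and \<open>m \<times> n\<close> matrices, never with the
  \<open>m n \<times> m n\<close> matrix of the equation in Kronecker form.

  Each stage is a straight-line program that composes a fixed number of these building blocks.
  So costs are measured in the unit \<open>m\<^sup>3 + n\<^sup>3\<close> by a triple \<open>costs c x P\<close>,
  which bounds the cost of \<open>x\<close> by \<open>c\<close> units and records in \<open>P\<close> the dimensions of the
  result, on which the cost of the later steps depends.  Sequential composition adds the
  coefficients, and these depend on \<open>\<kappa>\<close> and \<open>\<sigma>\<close> only.
\<close>

section \<open>Costs of the building blocks\<close>

lemma snd_bind_counted [simp]: "snd (bind_counted x f) = snd x + snd (f (fst x))"
  by (simp add: bind_counted_def)

lemma fst_bind_counted [simp]: "fst (bind_counted x f) = fst (f (fst x))"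
  by (simp add: bind_counted_def)

lemma counted_primitives [simp]:
  "snd (ret x) = 0" "snd (op1 f y) = 1" "snd (op2 g z w) = 1" "fst (ret x) = x"
  by (simp_all add: ret_def op1_def op2_def)

lemma mat_counted_carrier [simp]: "fst (mat_counted p q f) \<in> carrier_mat p q"
  by (simp add: mat_counted_def)

lemma mat_counted_cost:
  assumes "\<And>i j. i < p \<Longrightarrow> j < q \<Longrightarrow> snd (f (i, j)) \<le> c"
  shows "snd (mat_counted p q f) \<le> p * q * c"
proof -
  have "snd (mat_counted p q f) \<le> (\<Sum>i<p. \<Sum>j<q. c)"
    unfolding mat_counted_def snd_conv by (intro sum_mono) (auto intro: assms)
  then show ?thesis by simp
qed

lemma sum_counted_cost:
  assumes "\<And>s t. snd (pl s t) \<le> a" "\<And>l. l < k \<Longrightarrow> snd (f l) \<le> b"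
  shows "snd (sum_counted pl z f k) \<le> k * (a + b)"
  using assms(2)
proof (induction k)
  case (Suc k)
  have "snd (sum_counted pl z f k) \<le> k * (a + b)" "snd (f k) \<le> b"
    using Suc by auto
  then show ?case
    using assms(1)[of "fst (sum_counted pl z f k)" "fst (f k)"] by simp
qed simp

lemma mult_counted_cost:
  assumes "P \<in> carrier_mat p q" "Q \<in> carrier_mat q r"
    and "\<And>s t. snd (pl s t) \<le> a" "\<And>s t. snd (ti s t) \<le> b"
  shows "snd (mult_counted pl z ti P Q) \<le> p * q * r * (a + b)"
proof -
  have "snd (mult_counted pl z ti P Q) \<le> p * r * (q * (a + b))"
    using assms unfolding mult_counted_def
    by (auto intro!: mat_counted_cost sum_counted_cost)
  then show ?thesis by (simp add: ac_simps)
qed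

lemma pivot_counted_cost: "snd (pivot_counted W k r) = 3 * r"
  by (induction r) simp_all

text \<open>
  On a \<open>d \<times> 2 d\<close> matrix, the pivot search takes at most \<open>3 d\<close> operations, the scaling of
  the pivot row is charged with at most one and the elimination with at most two operations per entry.
\<close>

lemma gauss_jordan_step_cost:
  assumes "W \<in> carrier_mat d (2 * d)"
  shows "snd (gauss_jordan_step k W) \<le> 9 * d\<^sup>2"
proof -
  have dim: "dim_row W = d" "dim_col W = 2 * d"
    using assms by auto
  have "snd (gauss_jordan_step k W) \<le> 3 * (d - Suc k) + (d * (2 * d) * 1 + d * (2 * d) * 2)"
    unfolding gauss_jordan_step_def Let_def snd_bind_counted dim
    by (intro add_mono mat_counted_cost) (simp_all add: pivot_counted_cost)
  also have "\<dots> \<le> 3 * d\<^sup>2 + 6 * d\<^sup>2"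
  proof -
    have "d - Suc k \<le> d\<^sup>2" by (cases d) (simp_all add: power2_eq_square)
    then show ?thesis by (simp add: power2_eq_square)
  qed
  finally show ?thesis by simp
qed

lemma gauss_jordan_steps_cost:
  assumes "W \<in> carrier_mat d (2 * d)"
  shows "fst (gauss_jordan_steps W k) \<in> carrier_mat d (2 * d) \<and>
    snd (gauss_jordan_steps W k) \<le> k * (9 * d\<^sup>2)"
proof (induction k)
  case (Suc k)
  then show ?case
    using gauss_jordan_step_cost[of "fst (gauss_jordan_steps W k)" d k]
    by (auto simp: gauss_jordan_step_dim)
qed (simp add: assms)

lemma inverse_counted_cost:
  assumes "U \<in> carrier_mat d d"
  shows "fst (inverse_counted U) \<in> carrier_mat d d" "snd (inverse_counted U) \<le> 9 * d ^ 3"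
  using assms
    gauss_jordan_steps_cost[of "mat d (2 * d)
      (\<lambda>(i, j). if j < d then U $$ (i, j) else if j = d + i then 1 else 0)" d d]
  by (auto simp: inverse_counted_def Let_def power2_eq_square power3_eq_cube)

lemma mag_counted_cost: "snd (mag_counted x) = 2"
  by (simp add: mag_counted_def)

lemma ivl_arithmetic_cost:
  assumes "ivl_arithmetic \<kappa> ar"
  shows "snd (iadd ar x y) \<le> \<kappa>" "snd (isub ar x y) \<le> \<kappa>" "snd (imul ar x y) \<le> \<kappa>"
    "snd (idiv ar x y) \<le> \<kappa>" "snd (iinside ar x y) \<le> \<kappa>"
  using assms by (simp_all add: ivl_arithmetic_def)


section \<open>Counting in units of the cubed dimensions\<close>

locale sylvester_dimensions =
  fixes m n :: nat
  assumes pos: "1 \<le> m" "1 \<le> n"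
begin

text \<open>
  The postcondition \<open>P\<close> constrains the value of the computation: the dimensions of an intermediate
  matrix determine the cost of every later product in which it is a factor.
\<close>

definition costs :: "nat \<Rightarrow> 'a counted \<Rightarrow> ('a \<Rightarrow> bool) \<Rightarrow> bool" where
  "costs c x P \<longleftrightarrow> P (fst x) \<and> snd x \<le> c * (m ^ 3 + n ^ 3)"

text \<open>
  Products in which both dimensions meet cost \<open>m\<^sup>2 n\<close> or \<open>m n\<^sup>2\<close> steps;
  bounding each factor by \<open>max m n\<close> absorbs these mixed terms into the two cubes.
\<close>

lemma triple_product_le:
  assumes "p \<in> {m, n}" "q \<in> {m, n}" "r \<in> {m, n}"
  shows "p * q * r \<le> m ^ 3 + n ^ 3"
proof -
  have "p * q * r \<le> max m n * max m n * max m n"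
    using assms by (intro mult_mono) auto
  also have "\<dots> \<le> m ^ 3 + n ^ 3"
    by (simp add: max_def power3_eq_cube)
  finally show ?thesis .
qed

lemma double_product_le:
  assumes "p \<in> {m, n}" "q \<in> {m, n}"
  shows "p * q \<le> m ^ 3 + n ^ 3"
proof -
  have "p * q * 1 \<le> p * q * m" using pos by (intro mult_mono) auto
  also have "\<dots> \<le> m ^ 3 + n ^ 3" using assms by (intro triple_product_le) auto
  finally show ?thesis by simp
qed

lemma costs_weaken: "costs c x P \<Longrightarrow> c \<le> d \<Longrightarrow> costs d x P"
  unfolding costs_def by (meson le_trans mult_le_mono1)

text \<open>
  Read from the conclusion, the rule leaves the coefficients \<open>c\<close>, \<open>d\<close> and the intermediate
  condition \<open>P\<close> open; the rules for the individual operations fill them in, so that the cost of a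
  straight-line program is found by resolution along its syntax.
\<close>

lemma costs_bind:
  assumes "costs c x P" "\<And>y. P y \<Longrightarrow> costs d (f y) Q"
  shows "costs (c + d) (bind_counted x f) Q"
  using assms(1) assms(2)[of "fst x"] by (simp add: costs_def add_mult_distrib)

lemma costs_ret: "P x \<Longrightarrow> costs 0 (ret x) P"
  by (simp add: costs_def)

lemma costs_mat_counted:
  assumes "p \<in> {m, n}" "q \<in> {m, n}" "\<And>i j. i < p \<Longrightarrow> j < q \<Longrightarrow> snd (f (i, j)) \<le> c"
  shows "costs c (mat_counted p q f) (\<lambda>M. M \<in> carrier_mat p q)"
proof -
  have "snd (mat_counted p q f) \<le> p * q * c"
    using assms(3) by (rule mat_counted_cost)
  also have "\<dots> \<le> (m ^ 3 + n ^ 3) * c"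
    using double_product_le[OF assms(1,2)] by (rule mult_le_mono1)
  finally show ?thesis by (simp add: costs_def mult.commute)
qed

lemma costs_map_counted:
  assumes "P \<in> carrier_mat p q" "p \<in> {m, n}" "q \<in> {m, n}" "\<And>x. snd (f x) \<le> c"
  shows "costs c (map_counted f P) (\<lambda>M. M \<in> carrier_mat p q)"
  using assms costs_mat_counted[of p q "\<lambda>ij. f (P $$ ij)" c] by (simp add: map_counted_def)

lemma costs_zip_counted:
  assumes "P \<in> carrier_mat p q" "p \<in> {m, n}" "q \<in> {m, n}" "\<And>x y. snd (f x y) \<le> c"
  shows "costs c (zip_counted f P Q) (\<lambda>M. M \<in> carrier_mat p q)"
  using assms costs_mat_counted[of p q "\<lambda>ij. f (P $$ ij) (Q $$ ij)" c]
  by (simp add: zip_counted_def)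

lemma costs_mult_counted:
  assumes "P \<in> carrier_mat p q" "Q \<in> carrier_mat q r"
    and dims: "p \<in> {m, n}" "q \<in> {m, n}" "r \<in> {m, n}"
    and ops: "\<And>s t. snd (pl s t) \<le> a" "\<And>s t. snd (ti s t) \<le> a"
  shows "costs (2 * a) (mult_counted pl z ti P Q) (\<lambda>M. M \<in> carrier_mat p r)"
proof -
  have "snd (mult_counted pl z ti P Q) \<le> p * q * r * (a + a)"
    using assms by (intro mult_counted_cost)
  also have "\<dots> \<le> (m ^ 3 + n ^ 3) * (a + a)"
    using triple_product_le[OF dims] by (rule mult_le_mono1)
  finally have "snd (mult_counted pl z ti P Q) \<le> 2 * a * (m ^ 3 + n ^ 3)"
    by (simp add: algebra_simps)
  moreover have "fst (mult_counted pl z ti P Q) \<in> carrier_mat p r"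
    using assms(1,2) by (simp add: mult_counted_def mat_counted_def)
  ultimately show ?thesis by (simp add: costs_def)
qed

lemma costs_rmult:
  assumes "P \<in> carrier_mat p q" "Q \<in> carrier_mat q r"
    and "p \<in> {m, n}" "q \<in> {m, n}" "r \<in> {m, n}"
  shows "costs 2 (rmult P Q) (\<lambda>M. M \<in> carrier_mat p r)"
  using costs_mult_counted[OF assms, of "op2 (+)" 1 "op2 (*)" 0] by simp

lemma costs_imult:
  assumes "ivl_arithmetic \<kappa> ar" "P \<in> carrier_mat p q" "Q \<in> carrier_mat q r"
    and "p \<in> {m, n}" "q \<in> {m, n}" "r \<in> {m, n}"
  shows "costs (2 * \<kappa>) (imult ar P Q) (\<lambda>M. M \<in> carrier_mat p r)"
  using assms by (intro costs_mult_counted[where q = q]) (simp_all add: ivl_arithmetic_cost)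

lemma map_mat_carrierI: "M \<in> carrier_mat p q \<Longrightarrow> map_mat f M \<in> carrier_mat p q"
  by simp

lemma costs_transform:
  assumes "ivl_arithmetic \<kappa> ar"
    and "P \<in> carrier_mat p p" "M \<in> carrier_mat p q" "Q \<in> carrier_mat q q"
    and "p \<in> {m, n}" "q \<in> {m, n}"
  shows "costs (2 * \<kappa> + 2 * \<kappa>) (transform ar P M Q) (\<lambda>M. M \<in> carrier_mat p q)"
  unfolding transform_def
  by (rule costs_bind,
      (rule costs_imult[OF assms(1)] map_mat_carrierI assms(2-) | assumption)+)

lemma costs_symmetrize:
  assumes "M \<in> carrier_mat p q" "p \<in> {m, n}" "q \<in> {m, n}"
  shows "costs 2 (symmetrize_off_diagonal M) (\<lambda>M. M \<in> carrier_mat p q)"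
  using assms costs_mat_counted[of p q "\<lambda>(i, j). if i = j then ret (M $$ (i, j))
      else do { r \<leftarrow> mag_counted (M $$ (i, j)); ret (midrad 0 r) }" 2]
  by (simp add: symmetrize_off_diagonal_def mag_counted_cost)

lemma costs_inverse:
  assumes "U \<in> carrier_mat d d" "d \<in> {m, n}"
  shows "costs 9 (inverse_counted U) (\<lambda>M. M \<in> carrier_mat d d)"
  using inverse_counted_cost[OF assms(1)] assms(2) by (auto simp: costs_def)

text \<open>
  The continuation \<open>f\<close> may rely on the dimensions of \<open>U\<close>, which is a factor of later matrix
  products; the diagonal factors are only read entry by entry, at no charge.
\<close>

lemma costs_spectral_bind:
  assumes "cubic_spectral_routine \<sigma> R" "P \<in> carrier_mat d d" "Q \<in> carrier_mat d d"
    and "simultaneously_diagonalizable P Q" "d \<in> {m, n}"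
    and cont: "\<And>U D1 D2. U \<in> carrier_mat d d \<Longrightarrow> costs c (f U D1 D2) G"
  shows "costs (\<sigma> + c) (bind_counted (R P Q) (\<lambda>(U, D1, D2). f U D1 D2)) G"
proof -
  obtain U D1 D2 t where R: "R P Q = ((U, D1, D2), t)"
    by (metis prod.exhaust)
  have "case R P Q of ((U, D1, D2), t) \<Rightarrow>
      {U, D1, D2} \<subseteq> carrier_mat d d \<and> invertible_mat U \<and> diagonal_mat D1 \<and> diagonal_mat D2 \<and>
      t \<le> \<sigma> * d ^ 3"
    using assms(1) unfolding cubic_spectral_routine_def by (elim allE impE) (rule assms(2-4))+
  then have U: "U \<in> carrier_mat d d" and "t \<le> \<sigma> * d ^ 3"
    by (simp_all add: R)
  note this(2)
  also have "\<sigma> * d ^ 3 \<le> \<sigma> * (m ^ 3 + n ^ 3)"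
    using assms(5) by (intro mult_le_mono2) auto
  finally have "costs \<sigma> (R P Q) (\<lambda>(U, _). U \<in> carrier_mat d d)"
    using U by (simp add: costs_def R)
  then show ?thesis
    by (rule costs_bind) (auto simp: cont)
qed

end


section \<open>Costs of the stages of the algorithm\<close>

locale sylvester_arithmetic = sylvester_dimensions m n
  for m n :: nat +
  fixes \<kappa> :: nat and ar :: "'k :: real_normed_field ivl_ops"
  assumes arith: "ivl_arithmetic \<kappa> ar"
begin

text \<open>
  The invariant that \<open>initialize\<close> establishes and that the loop and the final transformation rely
  on.  The component \<open>pre_E\<close> is absent because entrywise operations are charged by the dimensions
  of their first operand, and \<open>pre_E\<close> is always the second.
\<close>

definition well_dimensioned :: "'k krawczyk_data \<Rightarrow> bool" where
  "well_dimensioned d \<longleftrightarrow>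
     left_factor d \<in> carrier_mat m m \<and> right_factor d \<in> carrier_mat n n \<and>
     pre_A d \<in> carrier_mat m m \<and> pre_B d \<in> carrier_mat n n \<and>
     pre_C d \<in> carrier_mat m m \<and> pre_D d \<in> carrier_mat n n \<and>
     pre_S d \<in> carrier_mat m n \<and> pre_X d \<in> carrier_mat m n \<and> pre_M d \<in> carrier_mat m n"

lemma dims: "m \<in> {m, n}" "n \<in> {m, n}"
  by simp_all

lemma op_cost: "snd (op1 f x) \<le> 1" "snd (op2 g x y) \<le> 1" "snd (mag_counted z) \<le> 2"
  by (simp_all add: mag_counted_cost)

text \<open>
  Resolution with these rules, tried in this order, is complete for the stages below: each operation
  matches one rule, and its side conditions on dimensions are met by the facts on the input matrices
  or by the postconditions of earlier operations.
\<close>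

lemmas step_rules = costs_rmult costs_imult[OF arith] costs_transform[OF arith]
  costs_symmetrize costs_inverse costs_map_counted costs_zip_counted
  dims map_mat_carrierI op_cost ivl_arithmetic_cost[OF arith]

lemma costs_initialize:
  assumes R: "cubic_spectral_routine \<sigma> R"
    and A: "iA \<in> carrier_mat m m" and C: "iC \<in> carrier_mat m m"
    and B: "iB \<in> carrier_mat n n" and D: "iD \<in> carrier_mat n n" and F: "iF \<in> carrier_mat m n"
    and AC: "simultaneously_diagonalizable (map_mat mid iA) (map_mat mid iC)"
    and BD: "simultaneously_diagonalizable (map_mat mid iB) (map_mat mid iD)"
  shows "costs (2 * \<sigma> + 33 * \<kappa> + 32) (initialize ar R eps iA iB iC iD iF) well_dimensioned"
proof -
  have S: "costs 3 (mat_counted m n (\<lambda>(i, j). do {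
            a \<leftarrow> op2 (*) (DB $$ (j, j)) (DA $$ (i, i));
            b \<leftarrow> op2 (*) (DD $$ (j, j)) (DC $$ (i, i));
            op2 (+) a b })) (\<lambda>M. M \<in> carrier_mat m n)" for DA DB DC DD :: "'k mat"
    by (rule costs_mat_counted) simp_all
  have E: "snd (do {
            r \<leftarrow> op2 (*) (1 / 10) (rad x);
            y \<leftarrow> imul ar (point (of_real r)) (midrad 0 1);
            z \<leftarrow> op2 (*) 10 eps;
            iadd ar y (midrad 0 z) }) \<le> 2 * \<kappa> + 2" for x :: "'k ivl"
    using ivl_arithmetic_cost(1)[OF arith] ivl_arithmetic_cost(3)[OF arith]
    by (simp add: add_mono mult_2)
  have dim: "dim_row iA = m" "dim_row iB = n"
    using A B by auto
  show ?thesis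
    unfolding initialize_def dim
    \<comment> \<open>Weakening comes first, so that the coefficient below it is synthesized and only then
      compared with the claimed one.\<close>
    apply (rule costs_weaken)
     apply (rule costs_spectral_bind[OF R _ _ AC], (rule map_mat_carrierI A C dims)+)
     apply (rule costs_spectral_bind[OF R _ _ BD], (rule map_mat_carrierI B D dims)+)
     apply (rule costs_bind, (rule S E A B C D F step_rules | assumption)+)+
     apply (rule costs_ret)
     apply (simp add: well_dimensioned_def)
    apply simp
    done
qed

lemma costs_iteration:
  assumes d: "well_dimensioned d" and H: "H \<in> carrier_mat m n"
  shows "costs (3 * \<kappa> + 27) (iteration ar d H)
    (\<lambda>(X, H', _). X \<in> carrier_mat m n \<and> H' \<in> carrier_mat m n)"
proof -
  have A: "pre_A d \<in> carrier_mat m m" and B: "pre_B d \<in> carrier_mat n n"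
    and C: "pre_C d \<in> carrier_mat m m" and D: "pre_D d \<in> carrier_mat n n"
    and S: "pre_S d \<in> carrier_mat m n" and M: "pre_M d \<in> carrier_mat m n"
    using d by (simp_all add: well_dimensioned_def)
  show ?thesis
    unfolding iteration_def Let_def
    apply (rule costs_weaken)
     apply (rule costs_bind, (rule A B C D S M H step_rules | assumption)+)+
     apply (rule costs_ret)
     apply simp
    apply simp
    done
qed

text \<open>
  The new \<open>H\<close> of each pass is again an \<open>m \<times> n\<close> matrix, so the bound for a single
  pass applies to all of them.  The dimensions of the final \<open>X\<close> are those that the concluding
  transformation by \<open>U\<close> and \<open>V\<inverse>\<close> needs.
\<close>

lemma krawczyk_loop_costs:
  assumes "well_dimensioned d" "H \<in> carrier_mat m n"
  shows "(\<forall>t \<in> set (snd (krawczyk_loop r ar d H)). t \<le> (3 * \<kappa> + 27) * (m ^ 3 + n ^ 3)) \<and>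
    (\<forall>X. fst (krawczyk_loop r ar d H) = Some X \<longrightarrow> X \<in> carrier_mat m n)"
  using assms(2)
proof (induction r arbitrary: H)
  case (Suc r)
  obtain X H' ready t where it: "iteration ar d H = ((X, H', ready), t)"
    by (metis prod.exhaust)
  have "X \<in> carrier_mat m n" "H' \<in> carrier_mat m n" "t \<le> (3 * \<kappa> + 27) * (m ^ 3 + n ^ 3)"
    using costs_iteration[OF assms(1) Suc.prems] by (simp_all add: costs_def it)
  moreover obtain res ts where "krawczyk_loop r ar d H' = (res, ts)"
    by (cases "krawczyk_loop r ar d H'")
  ultimately show ?case
    using Suc.IH[of H'] by (cases ready) (simp_all add: it)
qed simp

lemma costs_finalize:
  assumes d: "well_dimensioned d" and res: "\<And>X. res = Some X \<Longrightarrow> X \<in> carrier_mat m n"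
  shows "costs (5 * \<kappa>) (finalize ar d res) (\<lambda>_. True)"
proof (cases res)
  case None
  then show ?thesis
    by (simp add: finalize_def costs_def)
next
  case (Some X)
  have U: "left_factor d \<in> carrier_mat m m" and V: "right_factor d \<in> carrier_mat n n"
    and X: "pre_X d \<in> carrier_mat m n"
    using d by (simp_all add: well_dimensioned_def)
  show ?thesis
    unfolding finalize_def Some option.case
    apply (rule costs_weaken)
     apply (rule costs_bind, (rule U V X step_rules | assumption)+)+
     apply (rule costs_ret)
     apply simp
    apply simp
    done
qed

end

section \<open>The operation count of the modified Krawczyk algorithm\<close>

theorem theorem2p5:
  fixes \<kappa> \<sigma> :: nat
  shows "\<exists>c. \<forall>(ar :: 'k :: real_normed_field ivl_ops) R eps m n iA iB iC iD iF.
    ivl_arithmetic \<kappa> ar \<longrightarrow> cubic_spectral_routine \<sigma> R \<longrightarrow> 0 < eps \<longrightarrow> 1 \<le> m \<longrightarrow> 1 \<le> n \<longrightarrow>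
    iA \<in> ivl_mats m m \<longrightarrow> iC \<in> ivl_mats m m \<longrightarrow>
    iB \<in> ivl_mats n n \<longrightarrow> iD \<in> ivl_mats n n \<longrightarrow> iF \<in> ivl_mats m n \<longrightarrow>
    simultaneously_diagonalizable (map_mat mid iA) (map_mat mid iC) \<longrightarrow>
    simultaneously_diagonalizable (map_mat mid iB) (map_mat mid iD) \<longrightarrow>
    (let run = modified_krawczyk ar R eps iA iB iC iD iF in
       initial_cost run \<le> c * (m ^ 3 + n ^ 3) \<and>
       (\<forall>t \<in> set (iteration_costs run). t \<le> c * (m ^ 3 + n ^ 3)) \<and>
       final_cost run \<le> c * (m ^ 3 + n ^ 3))"
proof (intro exI allI impI)
  fix ar :: "'k ivl_ops" and R :: "'k spectral_routine" and eps :: real and m n :: nat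
    and iA iB iC iD iF :: "'k ivl mat"
  assume ar: "ivl_arithmetic \<kappa> ar" and R: "cubic_spectral_routine \<sigma> R"
    and mn: "1 \<le> m" "1 \<le> n"
    and mats: "iA \<in> ivl_mats m m" "iC \<in> ivl_mats m m" "iB \<in> ivl_mats n n" "iD \<in> ivl_mats n n"
      "iF \<in> ivl_mats m n"
    and diag: "simultaneously_diagonalizable (map_mat mid iA) (map_mat mid iC)"
      "simultaneously_diagonalizable (map_mat mid iB) (map_mat mid iD)"
  interpret sylvester_arithmetic m n \<kappa> ar
    using ar mn by unfold_locales
  \<comment> \<open>The coefficient of the preparation exceeds those of a single pass and of the output step.\<close>
  let ?c = "2 * \<sigma> + 33 * \<kappa> + 32" and ?N = "m ^ 3 + n ^ 3"
  obtain d t0 where init: "initialize ar R eps iA iB iC iD iF = (d, t0)"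
    by (rule prod.exhaust)
  obtain res ts where loop: "krawczyk_loop 15 ar d (pre_M d) = (res, ts)"
    by (rule prod.exhaust)
  obtain Z t1 where final: "finalize ar d res = (Z, t1)"
    by (rule prod.exhaust)
  have "costs ?c (initialize ar R eps iA iB iC iD iF) well_dimensioned"
    using mats by (intro costs_initialize R diag) (simp_all add: ivl_mats_def)
  then have d: "well_dimensioned d" and t0: "t0 \<le> ?c * ?N"
    by (simp_all add: costs_def init)
  have weaken: "t \<le> b * ?N \<Longrightarrow> b \<le> ?c \<Longrightarrow> t \<le> ?c * ?N" for t b
    by (rule le_trans[OF _ mult_le_mono1])
  have loop_costs: "\<forall>t \<in> set ts. t \<le> (3 * \<kappa> + 27) * ?N"
    and X: "\<And>X. res = Some X \<Longrightarrow> X \<in> carrier_mat m n"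
    using krawczyk_loop_costs[OF d, of "pre_M d" 15] d by (simp_all add: loop well_dimensioned_def)
  have ts: "\<forall>t \<in> set ts. t \<le> ?c * ?N"
    using loop_costs weaken[of _ "3 * \<kappa> + 27"] by auto
  have "t1 \<le> 5 * \<kappa> * ?N"
    using costs_finalize[of d res, OF d X] by (simp add: costs_def final)
  then have t1: "t1 \<le> ?c * ?N"
    by (rule weaken) simp
  show "let run = modified_krawczyk ar R eps iA iB iC iD iF in
       initial_cost run \<le> ?c * ?N \<and>
       (\<forall>t \<in> set (iteration_costs run). t \<le> ?c * ?N) \<and>
       final_cost run \<le> ?c * ?N"
    using t0 ts t1 by (simp add: modified_krawczyk_def Let_def init loop final)
qed

end
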